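(* Let $\delta>0$ and $\beta\in\mathbb R$, and let $\rho_\beta$ be the thermal state at inverse temperature $\beta$ of a qubit with Hamiltonian $\delta\sigma_z/2$. Among binary measurement schemes on the qubit, the set of measurements that are efficient with respect to the $\Delta$-disturbance $\mathfrak D^{(\Delta)}_\beta$ coincides with the set of semiclassical measurements.
   Context: Thermal model: $\rho_\beta=\frac{1}{2\cosh(\beta\delta/2)}\,\mathrm{diag}(e^{-\beta\delta/2},e^{\beta\delta/2})$, regarded as a one-parameter family in $\beta$ with $\delta$ fixed. Binary measurement schemes: $\mathscr M$ is given by a two-outcome POVM $\{\Pi_0,\Pi_1\}$ on $\mathbb C^2$ with non-zero elements, i.e. $\Pi_0,\Pi_1$ are non-zero Hermitian positive semidefinite $2\times2$ matrices with $\Pi_0+\Pi_1=\mathbb I_2$. Measurements are implemented by the Lüders instrument: outcome $i$ has probability $p_{i,\beta}=\mathrm{tr}(\rho_\beta\Pi_i)$, and the conditional state is $\rho_{\beta|i}=\sqrt{\Pi_i}\,\rho_\beta\sqrt{\Pi_i}/p_{i,\beta}$. Fisher information: $\mathcal F_\beta(\rho_\beta,\mathscr M)=\sum_i p_{i,\beta}\,(\partial_\beta\log p_{i,\beta})^2$. Quantum Fisher information: for a differentiable family of density matrices $\rho_\beta$, $\mathcal F^{(Q)}_\beta(\rho_\beta)=\mathrm{tr}(\rho_\beta L^2)$, where the symmetric logarithmic derivative $L$ is a Hermitian matrix with $\partial_\beta\rho_\beta=\tfrac12(\rho_\beta L+L\rho_\beta)$. $\Delta$-disturbance (average information loss): $\mathfrak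 D^{(\Delta)}_\beta(\mathscr M)=\mathcal F^{(Q)}_\beta(\rho_\beta)-\sum_i p_{i,\beta}\,\mathcal F^{(Q)}_\beta(\rho_{\beta|i})$, where $\mathcal F^{(Q)}_\beta(\rho_{\beta|i})$ is the quantum Fisher information of the family $\beta\mapsto\rho_{\beta|i}$. Semiclassical: all POVM elements commute with each other and with every $\rho_\beta$ of the thermal family (here, equivalently, $\Pi_0$ is diagonal). Efficient with respect to $\mathfrak D^{(\Delta)}_\beta$: $\mathscr M$ minimizes the disturbance at fixed extracted information, i.e. $\mathfrak D^{(\Delta)}_\beta(\mathscr M)\le\mathfrak D^{(\Delta)}_\beta(\mathscr M')$ for every binary measurement scheme $\mathscr M'$ with $\mathcal F_\beta(\rho_\beta,\mathscr M')=\mathcal F_\beta(\rho_\beta,\mathscr M)$. *)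

theory Defs
  imports "HOL-Analysis.Analysis"
begin

definition hermitian :: "complex^'n^'n \<Rightarrow> bool" where
  "hermitian A \<longleftrightarrow> (\<forall>i j. A $ i $ j = cnj (A $ j $ i))"

definition pos_semidef :: "complex^'n^'n \<Rightarrow> bool" where
  "pos_semidef A \<longleftrightarrow> hermitian A \<and> (\<forall>v. 0 \<le> Re (\<Sum>i\<in>UNIV. cnj (v $ i) * (A *v v) $ i))"

definition psd_sqrt :: "complex^'n^'n \<Rightarrow> complex^'n^'n" where
  "psd_sqrt A = (THE S. pos_semidef S \<and> S ** S = A)"

definition thermal :: "real \<Rightarrow> real \<Rightarrow> complex^2^2" where
  "thermal \<delta> \<beta> = (1 / (2 * cosh (\<beta> * \<delta> / 2))) *\<^sub>R
     vector [vector [complex_of_real (exp (- (\<beta> * \<delta> / 2))), 0],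
             vector [0, complex_of_real (exp (\<beta> * \<delta> / 2))]]"

text \<open>The outcomes 0 and 1 of a binary measurement are represented by the two elements of
  type \<^typ>\<open>bool\<close>.\<close>

definition binary_scheme :: "(bool \<Rightarrow> complex^2^2) \<Rightarrow> bool" where
  "binary_scheme M \<longleftrightarrow> (\<forall>i. pos_semidef (M i) \<and> M i \<noteq> 0) \<and> (\<Sum>i\<in>UNIV. M i) = mat 1"

text \<open>The traces below are real for Hermitian states and observables; \<^term>\<open>Re\<close> only
  changes the type.\<close>

definition outcome_prob :: "(real \<Rightarrow> complex^'n^'n) \<Rightarrow> ('k \<Rightarrow> complex^'n^'n) \<Rightarrow> 'k \<Rightarrow> real \<Rightarrow> real" where
  "outcome_prob \<rho> M i \<beta> = Re (trace (\<rho> \<beta> ** M i))"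

definition post_state ::
  "(real \<Rightarrow> complex^'n^'n) \<Rightarrow> ('k \<Rightarrow> complex^'n^'n) \<Rightarrow> 'k \<Rightarrow> real \<Rightarrow> complex^'n^'n" where
  "post_state \<rho> M i \<beta> =
     (1 / outcome_prob \<rho> M i \<beta>) *\<^sub>R (psd_sqrt (M i) ** \<rho> \<beta> ** psd_sqrt (M i))"

definition fisher_info :: "(real \<Rightarrow> complex^'n^'n) \<Rightarrow> ('k::finite \<Rightarrow> complex^'n^'n) \<Rightarrow> real \<Rightarrow> real" where
  "fisher_info \<rho> M \<beta> =
     (\<Sum>i\<in>UNIV. outcome_prob \<rho> M i \<beta> * (deriv (\<lambda>b. ln (outcome_prob \<rho> M i b)) \<beta>)\<^sup>2)"

definition is_sld :: "(real \<Rightarrow> complex^'n^'n) \<Rightarrow> real \<Rightarrow> complex^'n^'n \<Rightarrow> bool" where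
  "is_sld \<rho> \<beta> L \<longleftrightarrow> hermitian L \<and>
     (\<rho> has_vector_derivative (1 / 2) *\<^sub>R (\<rho> \<beta> ** L + L ** \<rho> \<beta>)) (at \<beta>)"

text \<open>For a rank-deficient state the symmetric logarithmic derivative is not unique, but the
  value of \<open>tr (\<rho> L\<^sup>2)\<close> is the same for all of them.\<close>

definition qfi :: "(real \<Rightarrow> complex^'n^'n) \<Rightarrow> real \<Rightarrow> real" where
  "qfi \<rho> \<beta> = (THE F. \<exists>L. is_sld \<rho> \<beta> L \<and> F = Re (trace (\<rho> \<beta> ** (L ** L))))"

definition disturbance :: "(real \<Rightarrow> complex^'n^'n) \<Rightarrow> ('k::finite \<Rightarrow> complex^'n^'n) \<Rightarrow> real \<Rightarrow> real" where
  "disturbance \<rho> M \<beta> =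
     qfi \<rho> \<beta> - (\<Sum>i\<in>UNIV. outcome_prob \<rho> M i \<beta> * qfi (post_state \<rho> M i) \<beta>)"

definition semiclassical :: "(real \<Rightarrow> complex^'n^'n) \<Rightarrow> ('k \<Rightarrow> complex^'n^'n) \<Rightarrow> bool" where
  "semiclassical \<rho> M \<longleftrightarrow>
     (\<forall>i j. M i ** M j = M j ** M i) \<and> (\<forall>i b. M i ** \<rho> b = \<rho> b ** M i)"

definition efficient :: "(real \<Rightarrow> complex^2^2) \<Rightarrow> real \<Rightarrow> (bool \<Rightarrow> complex^2^2) \<Rightarrow> bool" where
  "efficient \<rho> \<beta> M \<longleftrightarrow>
     (\<forall>M'. binary_scheme M' \<and> fisher_info \<rho> M' \<beta> = fisher_info \<rho> M \<beta>
        \<longrightarrow> disturbance \<rho> M \<beta> \<le> disturbance \<rho> M' \<beta>)"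

end

(* Let p, q be the thermal populations, let a, b be the diagonal entries of one POVM element, c its
   off-diagonal entry, P the probability of its outcome and D_i, P_i the determinant and probability
   belonging to outcome i. For a qubit state r the quantum Fisher information is
   2 tr(r'^2) + (det r)'^2 / det r; on the i-th conditional state this collapses to
   delta^2 p q D_i / P_i^2, while the thermal state itself has delta^2 p q. Summing up,

     disturbance = Fisher information + delta^2 p q |c|^2 / (P (1 - P)).

   The Fisher information does not involve c, so dephasing a scheme (setting c = 0) keeps it and
   lowers the disturbance strictly unless c = 0 already; and c = 0 means semiclassical. *)

theory Submission
  imports Defs
begin

section \<open>Symmetric logarithmic derivatives and the value of the quantum Fisher
  information\<close>

lemma matrix_add_rdistrib: "(B + C) ** A = B ** A + C ** A"
  for A :: "'a::semiring_1^'n^'m"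
  by (simp add: matrix_matrix_mult_def vec_eq_iff sum.distrib distrib_right)

text \<open>With R the state, the form (X, Y) -> tr ((R X + X R) Y) is symmetric by cyclicity of the
  trace. Both candidates have the same anticommutator with R, so \<open>L1\<close> can be exchanged
  for \<open>L2\<close> in one slot at a time. No inverse of R is taken, so pure states are
  covered.\<close>

lemma is_sld_trace_unique:
  fixes \<rho> :: "real \<Rightarrow> complex^'n^'n"
  assumes "is_sld \<rho> \<beta> L1" "is_sld \<rho> \<beta> L2"
  shows "trace (\<rho> \<beta> ** (L1 ** L1)) = trace (\<rho> \<beta> ** (L2 ** L2))"
proof -
  let ?R = "\<rho> \<beta>"
  have "(1 / 2) *\<^sub>R (?R ** L1 + L1 ** ?R) = (1 / 2) *\<^sub>R (?R ** L2 + L2 ** ?R)"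
    using assms vector_derivative_unique_at unfolding is_sld_def by blast
  then have eq: "?R ** L1 + L1 ** ?R = ?R ** L2 + L2 ** ?R"
    by simp
  have cyc: "trace (X ** ?R ** Y) = trace (?R ** (Y ** X))" for X Y
    by (metis matrix_mul_assoc trace_mul_sym)
  have key: "trace ((?R ** X + X ** ?R) ** Y) = trace (?R ** (X ** Y)) + trace (?R ** (Y ** X))" for X Y
    by (simp add: matrix_add_rdistrib trace_add cyc) (simp add: matrix_mul_assoc)
  have "2 * trace (?R ** (L1 ** L1)) = trace ((?R ** L1 + L1 ** ?R) ** L1)"
    using key[of L1 L1] by simp
  also have "\<dots> = trace ((?R ** L1 + L1 ** ?R) ** L2)"
    using key[of L2 L1, folded eq] key[of L1 L2] by simp
  also have "\<dots> = 2 * trace (?R ** (L2 ** L2))"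
    unfolding eq using key[of L2 L2] by simp
  finally show ?thesis by simp
qed

lemma qfi_eq:
  assumes "is_sld \<rho> \<beta> L"
  shows "qfi \<rho> \<beta> = Re (trace (\<rho> \<beta> ** (L ** L)))"
  unfolding qfi_def using assms by (auto intro!: the_equality dest: is_sld_trace_unique)

text \<open>The zero matrix is a symmetric logarithmic derivative here. This serves the conditional
  states left by rank-one POVM elements.\<close>

lemma qfi_zero_derivative:
  assumes "(\<rho> has_vector_derivative 0) (at \<beta>)"
  shows "qfi \<rho> \<beta> = 0"
proof -
  have z: "A ** 0 = 0" "0 ** A = 0" "trace (0 :: complex^'a^'a) = 0" for A :: "complex^'a^'a"
    by (simp_all add: matrix_matrix_mult_def trace_def vec_eq_iff)
  have "is_sld \<rho> \<beta> 0"
    using assms by (simp add: is_sld_def hermitian_def z)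
  from qfi_eq[OF this] show ?thesis by (simp add: z)
qed

section \<open>Quantum Fisher information of a qubit family\<close>

lemma matrix_eq_2_iff:
  "A = B \<longleftrightarrow> A $ 1 $ 1 = B $ 1 $ 1 \<and> A $ 1 $ 2 = B $ 1 $ 2 \<and> A $ 2 $ 1 = B $ 2 $ 1 \<and> A $ 2 $ 2 = B $ 2 $ 2"
  for A B :: "'a^2^2"
  by (auto simp: vec_eq_iff forall_2)

lemma matrix_mult_2_nth: "(A ** B) $ i $ j = A $ i $ 1 * B $ 1 $ j + A $ i $ 2 * B $ 2 $ j"
  for A B :: "complex^2^2"
  by (simp add: matrix_matrix_mult_def sum_2)

text \<open>By the polarised Cayley--Hamilton identity the derivative \<open>R'\<close> of a family of qubit states \<open>R\<close> has the
  symmetric logarithmic derivative \<open>2 R' + t (1 - R)\<close>, where \<open>t\<close> is the logarithmic derivative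
  of \<open>det R\<close>.\<close>

lemma qfi_qubit:
  fixes \<rho> :: "real \<Rightarrow> complex^2^2"
  assumes deriv: "(\<rho> has_vector_derivative R') (at \<beta>)"
    and herm: "hermitian (\<rho> \<beta>)" "hermitian R'"
    and tr: "trace (\<rho> \<beta>) = 1" "trace R' = 0"
    and t: "complex_of_real t * det (\<rho> \<beta>) = - trace (\<rho> \<beta> ** R')"
  shows "qfi \<rho> \<beta> = Re (2 * trace (R' ** R') + complex_of_real (t\<^sup>2) * det (\<rho> \<beta>))"
proof -
  define L where "L = 2 *\<^sub>R R' + t *\<^sub>R (mat 1 - \<rho> \<beta>)"
  obtain u v w where R: "\<rho> \<beta> $ 1 $ 1 = u" "\<rho> \<beta> $ 1 $ 2 = v" "\<rho> \<beta> $ 2 $ 1 = w" "\<rho> \<beta> $ 2 $ 2 = 1 - u"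
    using tr(1) by (simp add: trace_def sum_2 algebra_simps)
  obtain x y z where R': "R' $ 1 $ 1 = x" "R' $ 1 $ 2 = y" "R' $ 2 $ 1 = z" "R' $ 2 $ 2 = - x"
    using tr(2) by (simp add: trace_def sum_2 add_eq_0_iff)
  \<comment> \<open>At trace one, det R = (1 - tr (R^2)) / 2, so -tr (R R') is the derivative of det
    R. The assumption on \<open>t\<close> expresses the logarithmic derivative of det R without a
    division.\<close>
  have t': "t * (u * (1 - u) - v * w) = - (u * x + v * z + (w * y - (1 - u) * x))"
    using t by (simp add: R R' det_2 trace_def sum_2 matrix_matrix_mult_def algebra_simps)
  have L: "L $ 1 $ 1 = 2 * x + t * (1 - u)" "L $ 1 $ 2 = 2 * y - t * v"
    "L $ 2 $ 1 = 2 * z - t * w" "L $ 2 $ 2 = - 2 * x + t * u"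
    by (simp_all add: L_def R R' mat_def scaleR_conv_of_real[where 'a = complex])
  have "hermitian L"
    unfolding hermitian_def
  proof (intro allI)
    fix i j
    have "\<rho> \<beta> $ i $ j = cnj (\<rho> \<beta> $ j $ i)" "R' $ i $ j = cnj (R' $ j $ i)"
      using herm unfolding hermitian_def by blast+
    then show "L $ i $ j = cnj (L $ j $ i)"
      by (simp add: L_def mat_def)
  qed
  moreover have "(1 / 2) *\<^sub>R (\<rho> \<beta> ** L + L ** \<rho> \<beta>) = R'"
  proof -
    have "\<rho> \<beta> ** L + L ** \<rho> \<beta> = 2 *\<^sub>R R'"
    proof -
      \<comment> \<open>\<open>?E\<close> is t det R + tr (R R'), which vanishes by the choice of
        \<open>t\<close>. It is the only deviation of the anticommutator from 2 R', and it sits on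
        the diagonal.\<close>
      let ?E = "t * (u * (1 - u) - v * w) + (u * x + v * z + (w * y - (1 - u) * x))"
      have "(\<rho> \<beta> ** L + L ** \<rho> \<beta>) $ 1 $ 1 = 2 * x + 2 * ?E"
        "(\<rho> \<beta> ** L + L ** \<rho> \<beta>) $ 1 $ 2 = 2 * y"
        "(\<rho> \<beta> ** L + L ** \<rho> \<beta>) $ 2 $ 1 = 2 * z"
        "(\<rho> \<beta> ** L + L ** \<rho> \<beta>) $ 2 $ 2 = - 2 * x + 2 * ?E"
        by (simp_all add: matrix_mult_2_nth L R R' algebra_simps)
      then show ?thesis
        using t' by (simp add: matrix_eq_2_iff R' scaleR_conv_of_real[where 'a = complex])
    qed
    then show ?thesis by simp
  qed
  ultimately have "is_sld \<rho> \<beta> L"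
    using deriv by (simp add: is_sld_def)
  \<comment> \<open>Since tr L = t, Cayley-Hamilton gives L^2 = t L - det L; after multiplying by R
    and taking traces, the terms with tr (R R') cancel.\<close>
  moreover have "trace (\<rho> \<beta> ** (L ** L)) = 2 * trace (R' ** R') + complex_of_real (t\<^sup>2) * det (\<rho> \<beta>)"
    by (simp add: trace_def sum_2 matrix_mult_2_nth det_2 L R R') (simp add: algebra_simps power2_eq_square)
  ultimately show ?thesis
    by (simp add: qfi_eq)
qed

section \<open>Hermitian 2x2 matrices: positivity and square roots\<close>

definition herm2 :: "real \<Rightarrow> real \<Rightarrow> complex \<Rightarrow> complex^2^2" where
  "herm2 a b c = vector [vector [complex_of_real a, c], vector [cnj c, complex_of_real b]]"

lemma herm2_nth [simp]:
  "herm2 a b c $ 1 $ 1 = complex_of_real a" "herm2 a b c $ 1 $ 2 = c"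
  "herm2 a b c $ 2 $ 1 = cnj c" "herm2 a b c $ 2 $ 2 = complex_of_real b"
  by (simp_all add: herm2_def)

lemma herm2_inject: "herm2 a b c = herm2 a' b' c' \<longleftrightarrow> a = a' \<and> b = b' \<and> c = c'"
  by (auto simp: matrix_eq_2_iff)

lemma hermitian_2E:
  assumes "hermitian (A :: complex^2^2)"
  obtains a b c where "A = herm2 a b c"
proof
  show "A = herm2 (Re (A $ 1 $ 1)) (Re (A $ 2 $ 2)) (A $ 1 $ 2)"
  proof -
    have h: "A $ i $ j = cnj (A $ j $ i)" for i j
      using assms unfolding hermitian_def by blast
    have "Im (A $ i $ i) = 0" for i
      using arg_cong[OF h[of i i], of Im] by simp
    then show ?thesis
      using h[of 2 1] by (simp add: matrix_eq_2_iff complex_eq_iff)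
  qed
qed

lemma hermitian_herm2: "hermitian (herm2 a b c)"
  by (simp add: hermitian_def forall_2)

lemma herm2_quadratic_form:
  "Re (\<Sum>i\<in>UNIV. cnj (v $ i) * (herm2 a b c *v v) $ i) =
    a * (cmod (v $ 1))\<^sup>2 + b * (cmod (v $ 2))\<^sup>2 + 2 * Re (cnj (v $ 1) * c * v $ 2)"
  unfolding cmod_power2
  by (simp add: matrix_vector_mult_def sum_2) (simp add: algebra_simps power2_eq_square)

text \<open>For necessity the quadratic form is evaluated at the columns (b, -cnj c) and (-c, a) of
  the adjugate, where it equals b and a times the determinant. For sufficiency the cross term is at
  most 2 sqrt (a b) |x| |y|, which the diagonal terms dominate because (sqrt a |x| - sqrt b |y|)^2
  is nonnegative.\<close>

lemma pos_semidef_herm2_iff: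
  "pos_semidef (herm2 a b c) \<longleftrightarrow> 0 \<le> a \<and> 0 \<le> b \<and> (cmod c)\<^sup>2 \<le> a * b"
proof
  assume "pos_semidef (herm2 a b c)"
  then have "0 \<le> a * (cmod (v $ 1))\<^sup>2 + b * (cmod (v $ 2))\<^sup>2 + 2 * Re (cnj (v $ 1) * c * v $ 2)" for v :: "complex^2"
    unfolding pos_semidef_def herm2_quadratic_form by blast
  from this[of "vector [_, _]"]
  have Q: "0 \<le> a * (cmod x)\<^sup>2 + b * (cmod y)\<^sup>2 + 2 * Re (cnj x * c * y)" for x y
    by simp
  have a: "0 \<le> a" using Q[of 1 0] by simp
  have b: "0 \<le> b" using Q[of 0 1] by simp
  have cc: "Re (cnj c * c) = (cmod c)\<^sup>2"
    unfolding cmod_power2 by (simp add: power2_eq_square)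
  have "Re (cnj (- c) * c * complex_of_real a) = - a * (cmod c)\<^sup>2"
    "Re (cnj (complex_of_real b) * c * (- cnj c)) = - b * (cmod c)\<^sup>2"
    unfolding cmod_power2 by (simp_all add: power2_eq_square algebra_simps)
  then have 1: "0 \<le> a * (a * b - (cmod c)\<^sup>2)" and 2: "0 \<le> b * (a * b - (cmod c)\<^sup>2)"
    using Q[of "- c" "complex_of_real a"] Q[of "complex_of_real b" "- cnj c"]
    by (simp_all add: algebra_simps power2_eq_square)
  \<comment> \<open>If a = b = 0, the two inequalities above say nothing; the vector (-c, 1) then
    leaves -2 |c|^2 and forces c = 0.\<close>
  have 3: "0 \<le> a * (cmod c)\<^sup>2 + b - 2 * (cmod c)\<^sup>2"
    using Q[of "- c" 1] cc by simp
  have "(cmod c)\<^sup>2 \<le> a * b"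
  proof (cases "a = 0 \<and> b = 0")
    case True
    then show ?thesis using 3 by simp
  next
    case False
    then have "0 < a + b" using a b by linarith
    moreover have "0 \<le> (a + b) * (a * b - (cmod c)\<^sup>2)"
      using 1 2 by (simp add: algebra_simps)
    ultimately show ?thesis
      by (simp add: zero_le_mult_iff)
  qed
  with a b show "0 \<le> a \<and> 0 \<le> b \<and> (cmod c)\<^sup>2 \<le> a * b" by simp
next
  assume *: "0 \<le> a \<and> 0 \<le> b \<and> (cmod c)\<^sup>2 \<le> a * b"
  have "0 \<le> a * (cmod x)\<^sup>2 + b * (cmod y)\<^sup>2 + 2 * Re (cnj x * c * y)" for x y
  proof -
    have "cmod c \<le> sqrt a * sqrt b"
      using * by (metis real_le_rsqrt real_sqrt_mult)
    then have "cmod c * (cmod x * cmod y) \<le> (sqrt a * sqrt b) * (cmod x * cmod y)"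
      by (intro mult_right_mono) auto
    moreover have "\<bar>Re (cnj x * c * y)\<bar> \<le> cmod c * (cmod x * cmod y)"
      using abs_Re_le_cmod[of "cnj x * c * y"] by (simp add: norm_mult ac_simps)
    moreover have "0 \<le> (sqrt a * cmod x - sqrt b * cmod y)\<^sup>2" by simp
    then have "2 * ((sqrt a * sqrt b) * (cmod x * cmod y)) \<le> a * (cmod x)\<^sup>2 + b * (cmod y)\<^sup>2"
      using * by (simp add: power2_diff power_mult_distrib algebra_simps)
    ultimately show ?thesis by linarith
  qed
  then show "pos_semidef (herm2 a b c)"
    unfolding pos_semidef_def herm2_quadratic_form using hermitian_herm2 by blast
qed

lemma pos_semidef_2E:
  assumes "pos_semidef (A :: complex^2^2)"
  obtains a b c where "A = herm2 a b c" "0 \<le> a" "0 \<le> b" "(cmod c)\<^sup>2 \<le> a * b"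
proof -
  obtain a b c where "A = herm2 a b c"
    using assms hermitian_2E unfolding pos_semidef_def by blast
  with assms that show ?thesis by (simp add: pos_semidef_herm2_iff)
qed

lemma herm2_square:
  "herm2 a b c ** herm2 a b c = herm2 (a\<^sup>2 + (cmod c)\<^sup>2) (b\<^sup>2 + (cmod c)\<^sup>2) ((a + b) * c)"
  using complex_norm_square[of c, symmetric]
  by (simp add: matrix_eq_2_iff matrix_mult_2_nth power2_eq_square algebra_simps)

text \<open>Both parts rest on Cayley--Hamilton for the root \<open>S\<close>: \<open>A = S\<^sup>2 = tr S \<cdot> S - det S\<close>
  with \<open>det S = sqrt (det A)\<close>.\<close>

lemma psd_sqrt_herm2:
  assumes a: "0 \<le> a" and b: "0 \<le> b" and ab: "0 < a + b" and c: "(cmod c)\<^sup>2 \<le> a * b"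
    and d: "d = sqrt (a * b - (cmod c)\<^sup>2)" and s: "s = sqrt (a + b + 2 * d)"
  shows "psd_sqrt (herm2 a b c) = herm2 ((a + d) / s) ((b + d) / s) (c / s)"
    and "herm2 ((a + d) / s) ((b + d) / s) (c / s) ** herm2 ((a + d) / s) ((b + d) / s) (c / s) = herm2 a b c"
proof -
  have d0: "0 \<le> d" and d2: "d\<^sup>2 = a * b - (cmod c)\<^sup>2"
    using c by (simp_all add: d)
  have s0: "0 < s" and s2: "s\<^sup>2 = a + b + 2 * d"
    using d0 ab by (simp_all add: s)
  have c2: "(cmod c)\<^sup>2 = a * b - d\<^sup>2" using d2 by simp
  let ?S = "herm2 ((a + d) / s) ((b + d) / s) (c / s)"
  have "((a + d) / s)\<^sup>2 + (cmod (c / s))\<^sup>2 = a"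
    "((b + d) / s)\<^sup>2 + (cmod (c / s))\<^sup>2 = b"
  proof -
    have "(a + d)\<^sup>2 + (cmod c)\<^sup>2 = a * s\<^sup>2" "(b + d)\<^sup>2 + (cmod c)\<^sup>2 = b * s\<^sup>2"
      unfolding c2 s2 by algebra+
    then show "((a + d) / s)\<^sup>2 + (cmod (c / s))\<^sup>2 = a" "((b + d) / s)\<^sup>2 + (cmod (c / s))\<^sup>2 = b"
      using s0 by (simp_all add: power_divide norm_divide flip: add_divide_distrib)
  qed
  moreover have "complex_of_real ((a + d) / s + (b + d) / s) * (c / s) = c"
  proof -
    have "((a + d) / s + (b + d) / s) / s = (a + b + 2 * d) / s\<^sup>2"
      by (simp add: add_divide_distrib power2_eq_square)
    then have "((a + d) / s + (b + d) / s) / s = 1"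
      using s0 by (simp flip: s2)
    then show ?thesis
      by (metis mult.left_neutral of_real_1 of_real_divide times_divide_eq_left times_divide_eq_right)
  qed
  ultimately show sq: "?S ** ?S = herm2 a b c"
    unfolding herm2_square by (simp only: of_real_add)
  \<comment> \<open>The right-hand side is d s^2, the determinant (a + d) (b + d) - |c|^2 of the
    candidate root before division by s.\<close>
  have "0 \<le> a * d + b * d + 2 * d\<^sup>2"
    using a b d0 by simp
  then have "(cmod c)\<^sup>2 \<le> (a + d) * (b + d)"
    unfolding c2 by (simp add: algebra_simps power2_eq_square)
  then have "(cmod c)\<^sup>2 / s\<^sup>2 \<le> (a + d) * (b + d) / s\<^sup>2"
    by (simp add: divide_right_mono)
  then have psd: "pos_semidef ?S"
    unfolding pos_semidef_herm2_iff
    using a b d0 s0 by (simp add: norm_divide power_divide power2_eq_square)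
  show "psd_sqrt (herm2 a b c) = ?S"
    unfolding psd_sqrt_def
  proof (rule the_equality)
    show "pos_semidef ?S \<and> ?S ** ?S = herm2 a b c" using psd sq by simp
  next
    fix S assume S: "pos_semidef S \<and> S ** S = herm2 a b c"
    then obtain x y z where xyz: "S = herm2 x y z" "0 \<le> x" "0 \<le> y" "(cmod z)\<^sup>2 \<le> x * y"
      using pos_semidef_2E by blast
    have e: "x\<^sup>2 + (cmod z)\<^sup>2 = a" "y\<^sup>2 + (cmod z)\<^sup>2 = b" "(x + y) * z = c"
      using S unfolding xyz(1) herm2_square herm2_inject by simp_all
    \<comment> \<open>Uniqueness: any root S satisfies (det S)^2 = det A, and positivity selects det
      S = d. Then (tr S)^2 = s^2 gives tr S = s, and Cayley-Hamilton determines S itself.\<close>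
    have "(cmod c)\<^sup>2 = (x + y)\<^sup>2 * (cmod z)\<^sup>2"
      using e(3) by (metis norm_mult norm_of_real of_real_add power2_abs power_mult_distrib)
    then have "d\<^sup>2 = (x * y - (cmod z)\<^sup>2)\<^sup>2"
      unfolding d2 e(1,2)[symmetric] by (simp add: power2_eq_square algebra_simps)
    then have dd: "d = x * y - (cmod z)\<^sup>2"
      using d0 xyz(4) by (simp add: power2_eq_iff_nonneg)
    then have "s\<^sup>2 = (x + y)\<^sup>2"
      unfolding s2 e(1,2)[symmetric] by (simp add: power2_eq_square algebra_simps)
    then have ss: "s = x + y"
      using s0 xyz(2,3) by (simp add: power2_eq_iff_nonneg)
    have "x * s = a + d" "y * s = b + d" "z * s = c"
      unfolding dd ss e[symmetric] by (simp_all add: power2_eq_square algebra_simps)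
    then show "S = ?S"
      unfolding xyz(1) herm2_inject using s0 by (auto simp: field_simps)
  qed
qed

section \<open>The thermal family in terms of its populations\<close>

definition excited :: "real \<Rightarrow> real \<Rightarrow> real" where
  "excited \<delta> \<beta> = 1 / (1 + exp (\<beta> * \<delta>))"

text \<open>Both populations are the Boltzmann fractions expanded by exp (beta delta / 2), so that a
  single exponential remains to be differentiated instead of a quotient with
  \<open>cosh\<close>.\<close>

definition ground :: "real \<Rightarrow> real \<Rightarrow> real" where
  "ground \<delta> \<beta> = exp (\<beta> * \<delta>) / (1 + exp (\<beta> * \<delta>))"

lemma excited_pos: "0 < excited \<delta> \<beta>" and ground_pos: "0 < ground \<delta> \<beta>"
  by (simp_all add: excited_def ground_def add_pos_pos)

lemma excited_plus_ground: "excited \<delta> \<beta> + ground \<delta> \<beta> = 1"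
  using add_pos_pos[OF zero_less_one exp_gt_zero[of "\<beta> * \<delta>"]]
  by (simp add: excited_def ground_def flip: add_divide_distrib)

lemma thermal_eq: "thermal \<delta> \<beta> = herm2 (excited \<delta> \<beta>) (ground \<delta> \<beta>) 0"
proof -
  define x where "x = \<beta> * \<delta> / 2"
  have e: "exp (\<beta> * \<delta>) = exp x * exp x"
    by (simp add: x_def flip: exp_add)
  have c: "2 * cosh x = exp x + 1 / exp x"
    by (simp add: cosh_def exp_minus inverse_eq_divide)
  have "0 < 1 + exp x * exp x"
    by (intro add_pos_pos mult_pos_pos) auto
  then have n: "1 + exp x * exp x \<noteq> 0" "exp x \<noteq> 0"
    by (rule less_imp_neq[THEN not_sym], simp)
  have "excited \<delta> \<beta> = exp (- x) / (2 * cosh x)" "ground \<delta> \<beta> = exp x / (2 * cosh x)"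
    unfolding excited_def ground_def e c using n by (simp_all add: exp_minus field_simps)
  then show ?thesis
    by (simp add: thermal_def matrix_eq_2_iff scaleR_conv_of_real[where 'a = complex] x_def)
qed

lemma DERIV_excited:
  "(excited \<delta> has_real_derivative - (\<delta> * excited \<delta> \<beta> * ground \<delta> \<beta>)) (at \<beta>)"
proof -
  have "1 + exp (\<beta> * \<delta>) \<noteq> 0" using exp_gt_zero[of "\<beta> * \<delta>"] by linarith
  then show ?thesis
    unfolding excited_def ground_def
    by (auto intro!: derivative_eq_intros simp: field_simps power2_eq_square)
qed

lemma DERIV_ground:
  "(ground \<delta> has_real_derivative \<delta> * excited \<delta> \<beta> * ground \<delta> \<beta>) (at \<beta>)"
proof -
  have "ground \<delta> = (\<lambda>b. 1 - excited \<delta> b)"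
    using excited_plus_ground by (simp add: fun_eq_iff eq_diff_eq add.commute)
  then show ?thesis
    by (auto intro!: derivative_eq_intros DERIV_excited)
qed

lemma qfi_thermal: "qfi (thermal \<delta>) \<beta> = \<delta>\<^sup>2 * excited \<delta> \<beta> * ground \<delta> \<beta>"
proof -
  let ?p = "excited \<delta> \<beta>" and ?q = "ground \<delta> \<beta>"
  \<comment> \<open>The entries are the logarithmic derivatives of the populations, so
    \<open>?L\<close> is the mean energy minus the Hamiltonian and the quantum Fisher information is
    the energy variance.\<close>
  let ?L = "herm2 (- (\<delta> * ?q)) (\<delta> * ?p) 0"
  have "thermal \<delta> = (\<lambda>b. excited \<delta> b *\<^sub>R herm2 1 0 0 + ground \<delta> b *\<^sub>R herm2 0 1 0)"
    by (simp add: fun_eq_iff thermal_eq matrix_eq_2_iff scaleR_conv_of_real[where 'a = complex])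
  moreover have "((\<lambda>b. excited \<delta> b *\<^sub>R herm2 1 0 0 + ground \<delta> b *\<^sub>R herm2 0 1 0) has_vector_derivative
      (1 / 2) *\<^sub>R (thermal \<delta> \<beta> ** ?L + ?L ** thermal \<delta> \<beta>)) (at \<beta>)"
    by (auto intro!: derivative_eq_intros DERIV_excited DERIV_ground
        simp: thermal_eq matrix_eq_2_iff matrix_mult_2_nth scaleR_conv_of_real[where 'a = complex])
  ultimately have "is_sld (thermal \<delta>) \<beta> ?L"
    by (simp add: is_sld_def hermitian_herm2)
  then have "qfi (thermal \<delta>) \<beta> = ?p * (\<delta> * ?q)\<^sup>2 + ?q * (\<delta> * ?p)\<^sup>2"
    by (simp add: qfi_eq trace_def sum_2 matrix_mult_2_nth thermal_eq power2_eq_square)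
  also have "\<dots> = \<delta>\<^sup>2 * ?p * ?q * (?p + ?q)"
    by (simp add: power2_eq_square algebra_simps)
  finally show ?thesis by (simp add: excited_plus_ground)
qed

section \<open>Outcome probabilities and conditional states\<close>

lemma outcome_prob_thermal:
  assumes "M i = herm2 a b c"
  shows "outcome_prob (thermal \<delta>) M i = (\<lambda>\<beta>. excited \<delta> \<beta> * a + ground \<delta> \<beta> * b)"
  by (simp add: fun_eq_iff outcome_prob_def thermal_eq assms trace_def sum_2 matrix_mult_2_nth)

lemma DERIV_outcome_prob_thermal:
  "((\<lambda>b. excited \<delta> b * x + ground \<delta> b * y) has_real_derivative
    - (\<delta> * excited \<delta> \<beta> * ground \<delta> \<beta> * (x - y))) (at \<beta>)"
  by (auto intro!: derivative_eq_intros DERIV_excited DERIV_ground simp: algebra_simps)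

lemma outcome_prob_thermal_pos:
  assumes "0 \<le> a" "0 \<le> b" "0 < a + b"
  shows "0 < excited \<delta> \<beta> * a + ground \<delta> \<beta> * b"
  using assms excited_pos[of \<delta> \<beta>] ground_pos[of \<delta> \<beta>]
  by (smt (verit) mult_nonneg_nonneg mult_pos_pos)

text \<open>With S the root of a POVM element, this and the next two lemmas let traces and
  determinants of conditional states depend on S only through S^2, the element itself. The explicit
  root then stays out of the computation for elements of full rank.\<close>

lemma trace_sandwich: "trace (S ** X ** S) = trace (X ** (S ** S))"
  for S :: "complex^'n^'n"
  by (metis matrix_mul_assoc trace_mul_sym)

lemma trace_sandwich_mult:
  "trace ((S ** X ** S) ** (S ** Y ** S)) = trace (X ** (S ** S) ** Y ** (S ** S))"
  for S :: "complex^'n^'n"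
  by (metis matrix_mul_assoc trace_mul_sym)

lemma det_sandwich: "det (S ** X ** S) = det X * det (S ** S)"
  for S :: "complex^'n^'n"
  by (simp add: det_mul)

lemma herm2_diag_commute: "herm2 x y 0 ** herm2 u v 0 = herm2 u v 0 ** herm2 x y 0"
  by (simp add: matrix_eq_2_iff matrix_mult_2_nth)

lemma hermitian_sandwich:
  "hermitian (herm2 x y z ** herm2 u v w ** herm2 x y z)"
  by (simp add: hermitian_def forall_2 matrix_mult_2_nth algebra_simps)

lemma trace_diag_herm2: "trace (herm2 x y 0 ** herm2 a b c) = complex_of_real (x * a + y * b)"
  by (simp add: trace_def sum_2 matrix_mult_2_nth)

lemma trace_diag_herm2_twice:
  "trace (herm2 x y 0 ** herm2 a b c ** herm2 u v 0 ** herm2 a b c) =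
    complex_of_real (x * u * a\<^sup>2 + y * v * b\<^sup>2 + (x * v + y * u) * (cmod c)\<^sup>2)"
proof -
  have "complex_of_real ((cmod c)\<^sup>2) = c * cnj c"
    by (rule complex_norm_square)
  then show ?thesis
    unfolding of_real_add of_real_mult
    by (simp add: trace_def sum_2 matrix_mult_2_nth) (simp add: algebra_simps power2_eq_square)
qed

lemma det_herm2: "det (herm2 a b c) = complex_of_real (a * b - (cmod c)\<^sup>2)"
  using complex_norm_square[of c, symmetric] by (simp add: det_2)

text \<open>The conditional state is S diag(p/P, q/P) S with S the root of the element. An element
  of full rank is handled by \<open>qfi_qubit\<close>, where the two contributions combine through 4
  p q a b + (p a - q b)^2 = P^2; a singular element gives 0.\<close>

lemma qfi_post_state_thermal:
  assumes M: "M i = herm2 a b c"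
    and a: "0 \<le> a" and b: "0 \<le> b" and ab: "0 < a + b" and c: "(cmod c)\<^sup>2 \<le> a * b"
  shows "qfi (post_state (thermal \<delta>) M i) \<beta> =
    \<delta>\<^sup>2 * excited \<delta> \<beta> * ground \<delta> \<beta> * (a * b - (cmod c)\<^sup>2) / (excited \<delta> \<beta> * a + ground \<delta> \<beta> * b)\<^sup>2"
proof -
  define D where "D = a * b - (cmod c)\<^sup>2"
  define d where "d = sqrt D"
  define s where "s = sqrt (a + b + 2 * d)"
  define S where "S = herm2 ((a + d) / s) ((b + d) / s) (c / s)"
  have S: "psd_sqrt (M i) = S" "S ** S = herm2 a b c"
    using psd_sqrt_herm2[OF a b ab c] unfolding M S_def s_def d_def D_def by blast+
  define p where "p = excited \<delta> \<beta>"
  define q where "q = ground \<delta> \<beta>"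
  define P where "P = p * a + q * b"
  have pq: "0 < p" "0 < q" "p + q = 1"
    unfolding p_def q_def by (rule excited_pos ground_pos excited_plus_ground)+
  have Ppos: "0 < excited \<delta> x * a + ground \<delta> x * b" for x
    using outcome_prob_thermal_pos a b ab by blast
  then have P: "0 < P" by (simp add: P_def p_def q_def)
  \<comment> \<open>The derivatives of p/P and q/P are -b k and a k, as shown in \<open>d1\<close>
    and \<open>d2\<close>.\<close>
  define k where "k = \<delta> * p * q / P\<^sup>2"
  define R' where "R' = S ** herm2 (- (b * k)) (a * k) 0 ** S"
  let ?\<rho> = "post_state (thermal \<delta>) M i"
  \<comment> \<open>All dependence on the temperature is moved into two scalar factors of fixed
    matrices, so differentiation reduces to two real quotient rules.\<close>
  have family: "?\<rho> = (\<lambda>x. (excited \<delta> x / (excited \<delta> x * a + ground \<delta> x * b)) *\<^sub>R (S ** herm2 1 0 0 ** S) +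
      (ground \<delta> x / (excited \<delta> x * a + ground \<delta> x * b)) *\<^sub>R (S ** herm2 0 1 0 ** S))"
    by (simp add: fun_eq_iff post_state_def outcome_prob_thermal[of M i, OF M] thermal_eq S(1)
        matrix_eq_2_iff matrix_mult_2_nth scaleR_conv_of_real[where 'a = complex] add_divide_distrib algebra_simps)
  have at: "?\<rho> \<beta> = S ** herm2 (p / P) (q / P) 0 ** S"
    unfolding family p_def[symmetric] q_def[symmetric] P_def[symmetric]
    by (simp add: matrix_eq_2_iff matrix_mult_2_nth scaleR_conv_of_real[where 'a = complex] algebra_simps)
  have d1: "((\<lambda>x. excited \<delta> x / (excited \<delta> x * a + ground \<delta> x * b)) has_real_derivative - (b * k)) (at \<beta>)"
  proof -
    \<comment> \<open>The factor p + q is kept to make this a polynomial identity in independent p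
      and q; only afterwards is it replaced by 1.\<close>
    have "- (\<delta> * p * q) * P - p * - (\<delta> * p * q * (a - b)) = - (b * (\<delta> * p * q)) * (p + q)"
      unfolding P_def by algebra
    then have "(- (\<delta> * p * q) * P - p * - (\<delta> * p * q * (a - b))) / (P * P) = - (b * k)"
      unfolding pq by (simp add: k_def power2_eq_square)
    then show ?thesis
      using Ppos[of \<beta>] unfolding p_def q_def P_def
      by (intro DERIV_cong[OF DERIV_divide[OF DERIV_excited DERIV_outcome_prob_thermal]]) auto
  qed
  have d2: "((\<lambda>x. ground \<delta> x / (excited \<delta> x * a + ground \<delta> x * b)) has_real_derivative a * k) (at \<beta>)"
  proof -
    have "(\<delta> * p * q) * P - q * - (\<delta> * p * q * (a - b)) = a * (\<delta> * p * q) * (p + q)"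
      unfolding P_def by algebra
    then have "((\<delta> * p * q) * P - q * - (\<delta> * p * q * (a - b))) / (P * P) = a * k"
      unfolding pq by (simp add: k_def power2_eq_square)
    then show ?thesis
      using Ppos[of \<beta>] unfolding p_def q_def P_def
      by (intro DERIV_cong[OF DERIV_divide[OF DERIV_ground DERIV_outcome_prob_thermal]]) auto
  qed
  have "R' = - (b * k) *\<^sub>R (S ** herm2 1 0 0 ** S) + (a * k) *\<^sub>R (S ** herm2 0 1 0 ** S)"
    by (simp add: R'_def matrix_eq_2_iff matrix_mult_2_nth scaleR_conv_of_real[where 'a = complex] algebra_simps)
  then have deriv: "(?\<rho> has_vector_derivative R') (at \<beta>)"
    unfolding family
    using has_vector_derivative_add[OF has_vector_derivative_scaleR[OF d1 has_vector_derivative_const]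
        has_vector_derivative_scaleR[OF d2 has_vector_derivative_const]]
    by simp
  have "qfi ?\<rho> \<beta> = \<delta>\<^sup>2 * p * q * D / P\<^sup>2"
  proof (cases "D = 0")
    case True
    \<comment> \<open>The element has rank one and its root is the element divided by s. The
      conditional state is then a fixed pure state, whence \<open>R' = 0\<close>.\<close>
    then have "d = 0" and "a * b = (cmod c)\<^sup>2"
      by (simp_all add: d_def D_def)
    then have "c * cnj c = complex_of_real a * complex_of_real b"
      by (metis complex_norm_square of_real_mult)
    then have "R' = 0"
      unfolding R'_def S_def \<open>d = 0\<close>
      by (simp add: matrix_eq_2_iff matrix_mult_2_nth field_simps)
    with deriv True show ?thesis
      by (simp add: qfi_zero_derivative)
  next
    case False
    \<comment> \<open>This is the logarithmic derivative of the determinant p q D / P^2 of the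
      conditional state, simplified by p + q = 1.\<close>
    define t where "t = \<delta> * (p * a - q * b) / P"
    have det: "det (?\<rho> \<beta>) = complex_of_real (p * q * D / P\<^sup>2)"
      unfolding at det_sandwich S(2) det_herm2 by (simp add: D_def power2_eq_square)
    have tr: "trace (?\<rho> \<beta> ** R') = complex_of_real (- k * (p * a - q * b) * D / P)"
      unfolding at R'_def trace_sandwich_mult S(2) trace_diag_herm2_twice of_real_eq_iff
      using P by (simp add: D_def field_simps power2_eq_square)
    have tr': "trace (R' ** R') = complex_of_real (2 * k\<^sup>2 * a * b * D)"
      unfolding R'_def trace_sandwich_mult S(2) trace_diag_herm2_twice of_real_eq_iff D_def
      by algebra
    have "qfi ?\<rho> \<beta> = Re (2 * trace (R' ** R') + complex_of_real (t\<^sup>2) * det (?\<rho> \<beta>))"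
    proof (rule qfi_qubit[OF deriv])
      show "hermitian (?\<rho> \<beta>)" "hermitian R'"
        unfolding at R'_def S_def by (rule hermitian_sandwich)+
      have "p / P * a + q / P * b = 1"
        using P by (simp add: P_def flip: add_divide_distrib)
      then show "trace (?\<rho> \<beta>) = 1"
        unfolding at trace_sandwich S(2) trace_diag_herm2 by simp
      show "trace R' = 0"
        unfolding R'_def trace_sandwich S(2) trace_diag_herm2 by simp
      have "t * (p * q * D / P\<^sup>2) = - (- k * (p * a - q * b) * D / P)"
        by (simp add: t_def k_def power2_eq_square mult_ac)
      then show "complex_of_real t * det (?\<rho> \<beta>) = - trace (?\<rho> \<beta> ** R')"
        unfolding det tr by (metis of_real_minus of_real_mult)
    qed
    also have "\<dots> = 4 * k\<^sup>2 * a * b * D + t\<^sup>2 * (p * q * D / P\<^sup>2)"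
      unfolding tr' det of_real_mult[symmetric] by simp
    also have "\<dots> = \<delta>\<^sup>2 * p * q * D * (4 * p * q * a * b + (p * a - q * b)\<^sup>2) / (P\<^sup>2 * P\<^sup>2)"
      using P by (simp add: k_def t_def power_divide power_mult_distrib field_simps power2_eq_square)
    also have "4 * p * q * a * b + (p * a - q * b)\<^sup>2 = P\<^sup>2"
      unfolding P_def by algebra
    finally show ?thesis
      using P by (simp add: divide_simps power2_eq_square power4_eq_xxxx)
  qed
  then show ?thesis by (simp add: p_def q_def P_def D_def)
qed

section \<open>Extracted information and disturbance of a binary scheme\<close>

lemma fisher_info_thermal:
  fixes M :: "bool \<Rightarrow> complex^2^2"
  assumes M: "\<And>i. M i = herm2 (a i) (b i) (c i)"
    and nonneg: "\<And>i. 0 \<le> a i" "\<And>i. 0 \<le> b i" "\<And>i. 0 < a i + b i"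
  shows "fisher_info (thermal \<delta>) M \<beta> =
    (\<Sum>i\<in>UNIV. (\<delta> * excited \<delta> \<beta> * ground \<delta> \<beta> * (a i - b i))\<^sup>2 / (excited \<delta> \<beta> * a i + ground \<delta> \<beta> * b i))"
  unfolding fisher_info_def
proof (rule sum.cong)
  fix i
  let ?P = "\<lambda>x. excited \<delta> x * a i + ground \<delta> x * b i"
  have P: "0 < ?P \<beta>" using outcome_prob_thermal_pos nonneg by blast
  have "((\<lambda>x. ln (?P x)) has_real_derivative
      1 / ?P \<beta> * - (\<delta> * excited \<delta> \<beta> * ground \<delta> \<beta> * (a i - b i))) (at \<beta>)"
    using DERIV_chain2[OF DERIV_ln_divide[OF P] DERIV_outcome_prob_thermal] .
  then have "deriv (\<lambda>x. ln (?P x)) \<beta> = - (\<delta> * excited \<delta> \<beta> * ground \<delta> \<beta> * (a i - b i)) / ?P \<beta>"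
    by (simp add: DERIV_imp_deriv)
  then show "outcome_prob (thermal \<delta>) M i \<beta> * (deriv (\<lambda>b. ln (outcome_prob (thermal \<delta>) M i b)) \<beta>)\<^sup>2 =
      (\<delta> * excited \<delta> \<beta> * ground \<delta> \<beta> * (a i - b i))\<^sup>2 / ?P \<beta>"
    unfolding outcome_prob_thermal[of M i, OF M] using P by (simp add: power_divide power2_eq_square)
qed simp

text \<open>A positive semidefinite matrix is zero exactly when its trace is, so the two elements
  being non-zero amounts to 0 < a + b and a + b < 2.\<close>

lemma binary_scheme_herm2_iff:
  assumes M: "M True = herm2 a b c" "M False = herm2 (1 - a) (1 - b) (- c)"
  shows "binary_scheme M \<longleftrightarrow> 0 \<le> a \<and> 0 \<le> b \<and> (cmod c)\<^sup>2 \<le> a * b \<and> 0 < a + b \<and>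
    a \<le> 1 \<and> b \<le> 1 \<and> (cmod c)\<^sup>2 \<le> (1 - a) * (1 - b) \<and> a + b < 2"
proof -
  have zero: "herm2 x y z = 0 \<longleftrightarrow> x = 0 \<and> y = 0 \<and> z = 0" for x y z
    by (auto simp: matrix_eq_2_iff)
  have nonzero: "pos_semidef (herm2 x y z) \<and> herm2 x y z \<noteq> 0 \<longleftrightarrow>
      0 \<le> x \<and> 0 \<le> y \<and> (cmod z)\<^sup>2 \<le> x * y \<and> 0 < x + y" for x y z
    unfolding pos_semidef_herm2_iff zero by (cases "x = 0"; cases "y = 0") (auto intro: add_nonneg_pos add_pos_nonneg)
  have "M True + M False = mat 1"
    by (simp add: M matrix_eq_2_iff mat_def)
  then show ?thesis
    unfolding binary_scheme_def all_bool_eq M nonzero by (auto simp: UNIV_bool add.commute M)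
qed

lemma binary_schemeE:
  assumes "binary_scheme M"
  obtains a b c where "M True = herm2 a b c" "M False = herm2 (1 - a) (1 - b) (- c)"
proof -
  obtain a b c where t: "M True = herm2 a b c"
    using assms pos_semidef_2E unfolding binary_scheme_def by metis
  have "M False = mat 1 - M True"
    using assms by (simp add: binary_scheme_def UNIV_bool eq_diff_eq)
  also have "\<dots> = herm2 (1 - a) (1 - b) (- c)"
    by (simp add: t matrix_eq_2_iff mat_def)
  finally show ?thesis using that t by blast
qed

lemma disturbance_thermal:
  fixes \<delta> \<beta> :: real
  assumes bin: "binary_scheme M" and M: "M True = herm2 a b c" "M False = herm2 (1 - a) (1 - b) (- c)"
  defines "P \<equiv> excited \<delta> \<beta> * a + ground \<delta> \<beta> * b"
  shows "disturbance (thermal \<delta>) M \<beta> = fisher_info (thermal \<delta>) M \<beta> +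
    \<delta>\<^sup>2 * excited \<delta> \<beta> * ground \<delta> \<beta> * (cmod c)\<^sup>2 / (P * (1 - P))"
    and "0 < P" "P < 1"
proof -
  define p where "p = excited \<delta> \<beta>"
  define q where "q = ground \<delta> \<beta>"
  have q: "q = 1 - p"
    using excited_plus_ground[of \<delta> \<beta>] by (simp add: p_def q_def)
  have ab: "0 \<le> a" "0 \<le> b" "(cmod c)\<^sup>2 \<le> a * b" "0 < a + b" "0 \<le> 1 - a" "0 \<le> 1 - b"
    "(cmod (- c))\<^sup>2 \<le> (1 - a) * (1 - b)" "0 < (1 - a) + (1 - b)"
    using bin unfolding binary_scheme_herm2_iff[OF M] by auto
  have P1: "p * (1 - a) + q * (1 - b) = 1 - P"
    unfolding P_def p_def[symmetric] q_def[symmetric] q by (simp add: algebra_simps)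
  show "0 < P" unfolding P_def by (rule outcome_prob_thermal_pos[OF ab(1,2,4)])
  have "0 < 1 - P"
    unfolding P1[symmetric] p_def q_def by (rule outcome_prob_thermal_pos[OF ab(5,6,8)])
  then show "P < 1" by simp
  define X where "X = \<delta> * p * q * (a - b)"
  have F: "fisher_info (thermal \<delta>) M \<beta> = X\<^sup>2 / P + X\<^sup>2 / (1 - P)"
  proof -
    have Mi: "M i = herm2 (if i then a else 1 - a) (if i then b else 1 - b) (if i then c else - c)" for i
      by (cases i) (simp_all add: M)
    have "X\<^sup>2 = (\<delta> * p * q * ((1 - a) - (1 - b)))\<^sup>2"
      by (simp add: X_def power_mult_distrib power2_commute)
    then show ?thesis
      using ab by (subst fisher_info_thermal[OF Mi])
        (auto simp: UNIV_bool P1[unfolded p_def q_def] P_def X_def p_def q_def)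
  qed
  define W where "W = \<delta>\<^sup>2 * p * q"
  define n where "n = (cmod c)\<^sup>2"
  have "disturbance (thermal \<delta>) M \<beta> =
      W - (P * (W * (a * b - n) / P\<^sup>2) + (1 - P) * (W * ((1 - a) * (1 - b) - n) / (1 - P)\<^sup>2))"
    unfolding disturbance_def qfi_thermal
    using qfi_post_state_thermal[of M, OF M(1) ab(1,2,4,3)] qfi_post_state_thermal[of M, OF M(2) ab(5,6,8,7)]
      outcome_prob_thermal[of M, OF M(1)] outcome_prob_thermal[of M, OF M(2)] P1
    by (simp add: UNIV_bool P_def W_def n_def p_def q_def)
  also have "\<dots> = (W * (P * (1 - P)) - W * (a * b - n) * (1 - P) - W * ((1 - a) * (1 - b) - n) * P) / (P * (1 - P))"
    using \<open>0 < P\<close> \<open>0 < 1 - P\<close> by (simp add: divide_simps power2_eq_square)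
  \<comment> \<open>The terms with n add up to W n. The rest is W (P - a) (b - P), and since P = p a
    + q b is a weighted mean, this is W p q (a - b)^2 = X^2.\<close>
  also have "W * (P * (1 - P)) - W * (a * b - n) * (1 - P) - W * ((1 - a) * (1 - b) - n) * P = X\<^sup>2 + W * n"
    unfolding W_def X_def P_def p_def[symmetric] q_def[symmetric] q by algebra
  also have "(X\<^sup>2 + W * n) / (P * (1 - P)) = X\<^sup>2 / P + X\<^sup>2 / (1 - P) + W * n / (P * (1 - P))"
    using \<open>0 < P\<close> \<open>0 < 1 - P\<close> by (simp add: divide_simps) (simp add: algebra_simps)
  finally show "disturbance (thermal \<delta>) M \<beta> = fisher_info (thermal \<delta>) M \<beta> +
    \<delta>\<^sup>2 * excited \<delta> \<beta> * ground \<delta> \<beta> * (cmod c)\<^sup>2 / (P * (1 - P))"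
    unfolding F by (simp add: W_def n_def p_def q_def)
qed

section \<open>Semiclassical schemes and efficiency\<close>

lemma semiclassical_thermal_iff:
  assumes "\<delta> > 0" and M: "M True = herm2 a b c" "M False = herm2 (1 - a) (1 - b) (- c)"
  shows "semiclassical (thermal \<delta>) M \<longleftrightarrow> c = 0"
proof
  assume "semiclassical (thermal \<delta>) M"
  \<comment> \<open>At inverse temperature 0 the state is maximally mixed and commutes with
    everything, so the given temperature may carry no information. The family also contains inverse
    temperature 1, where the populations differ because delta > 0.\<close>
  then have "M True ** thermal \<delta> 1 = thermal \<delta> 1 ** M True"
    unfolding semiclassical_def by blast
  then have "c * complex_of_real (ground \<delta> 1) = complex_of_real (excited \<delta> 1) * c"
    by (simp add: M thermal_eq matrix_eq_2_iff matrix_mult_2_nth)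
  moreover have "excited \<delta> 1 < ground \<delta> 1"
    using assms(1) by (simp add: excited_def ground_def divide_strict_right_mono add_pos_pos)
  ultimately show "c = 0" by auto
next
  assume "c = 0"
  then have "\<exists>x y. M i = herm2 x y 0" for i
    by (cases i) (auto simp: M)
  then show "semiclassical (thermal \<delta>) M"
    unfolding semiclassical_def thermal_eq by (metis herm2_diag_commute)
qed

theorem mainTheorem3:
  fixes \<delta> \<beta> :: real
  assumes "\<delta> > 0"
  shows "{M. binary_scheme M \<and> efficient (thermal \<delta>) \<beta> M} =
         {M. binary_scheme M \<and> semiclassical (thermal \<delta>) M}"
proof -
  have "efficient (thermal \<delta>) \<beta> M \<longleftrightarrow> semiclassical (thermal \<delta>) M" if bin: "binary_scheme M" for M
  proof -
    obtain a b c where M: "M True = herm2 a b c" "M False = herm2 (1 - a) (1 - b) (- c)"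
      using binary_schemeE[OF bin] .
    note dist = disturbance_thermal[OF bin M, of \<delta> \<beta>]
    note sc = semiclassical_thermal_iff[OF assms M]
    have W: "0 < \<delta>\<^sup>2 * excited \<delta> \<beta> * ground \<delta> \<beta>"
      using assms by (simp add: excited_pos ground_pos)
    show ?thesis
    proof
      assume eff: "efficient (thermal \<delta>) \<beta> M"
      define N where "N = (\<lambda>i. if i then herm2 a b 0 else herm2 (1 - a) (1 - b) 0)"
      \<comment> \<open>The entry \<open>- 0\<close> gives the dephased scheme the shape that the
        lemmas expect, with c = 0.\<close>
      have N: "N True = herm2 a b 0" "N False = herm2 (1 - a) (1 - b) (- 0)"
        by (simp_all add: N_def)
      have binN: "binary_scheme N"
        using bin unfolding binary_scheme_herm2_iff[OF M] binary_scheme_herm2_iff[OF N] by simp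
      note distN = disturbance_thermal[OF binN N, of \<delta> \<beta>]
      \<comment> \<open>A diagonal state sees only the diagonal of a POVM element, so the
        probabilities agree as functions of the temperature, and with them their
        derivatives.\<close>
      have "outcome_prob (thermal \<delta>) N i = outcome_prob (thermal \<delta>) M i" for i
        using outcome_prob_thermal[of M, OF M(1)] outcome_prob_thermal[of M, OF M(2)]
          outcome_prob_thermal[of N, OF N(1)] outcome_prob_thermal[of N, OF N(2)]
        by (cases i) simp_all
      then have fisher: "fisher_info (thermal \<delta>) N \<beta> = fisher_info (thermal \<delta>) M \<beta>"
        by (simp add: fisher_info_def)
      with eff binN have "disturbance (thermal \<delta>) M \<beta> \<le> disturbance (thermal \<delta>) N \<beta>"
        unfolding efficient_def by blast
      then have "\<delta>\<^sup>2 * excited \<delta> \<beta> * ground \<delta> \<beta> * (cmod c)\<^sup>2 /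
          ((excited \<delta> \<beta> * a + ground \<delta> \<beta> * b) * (1 - (excited \<delta> \<beta> * a + ground \<delta> \<beta> * b))) \<le> 0"
        using dist(1) distN(1) fisher by simp
      then have "c = 0"
        using W dist(2,3) by (auto simp: divide_le_0_iff mult_le_0_iff zero_less_mult_iff)
      then show "semiclassical (thermal \<delta>) M" by (simp add: sc)
    next
      assume "semiclassical (thermal \<delta>) M"
      then have eq: "disturbance (thermal \<delta>) M \<beta> = fisher_info (thermal \<delta>) M \<beta>"
        using dist(1) by (simp add: sc)
      \<comment> \<open>The Fisher information bounds the disturbance of every scheme from below,
        and \<open>eq\<close> says that \<open>M\<close> attains this bound; competitors with the
        same Fisher information cannot fall below it.\<close>
      have "fisher_info (thermal \<delta>) N \<beta> \<le> disturbance (thermal \<delta>) N \<beta>" if binN: "binary_scheme N" for N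
      proof -
        obtain a b c where N: "N True = herm2 a b c" "N False = herm2 (1 - a) (1 - b) (- c)"
          using binary_schemeE[OF binN] .
        note distN = disturbance_thermal[OF binN N, of \<delta> \<beta>]
        show ?thesis
          unfolding distN(1) using distN(2,3) W by simp
      qed
      then show "efficient (thermal \<delta>) \<beta> M"
        unfolding efficient_def eq by metis
    qed
  qed
  then show ?thesis by blast
qed

end
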